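(* Let $N\ge3$, $p\in[1,\frac N{N-2})$, $\Omega\subset\mathbb{R}^N$ a bounded domain of class $C^{2,\beta}$ with $|\Omega|=1$, and let $(\alpha_n,\psi_n)$ be solutions of $(\mathbf{P}_{\lambda_n})$ with $\alpha_n<0$ and $|\alpha_n|\to+\infty$. Then $\lambda_n\to+\infty$ and $\lambda_n\|\psi_n\|_\infty\to+\infty$.
   Context: Problem $(\mathbf{P}_\lambda)$ ($\lambda>0$): find $(\alpha,\psi)\in\mathbb{R}\times C^{2,\beta}(\overline\Omega)$ with $-\Delta\psi=[\alpha+\lambda\psi]_+^p$ in $\Omega$, $\psi=0$ on $\partial\Omega$, $\int_\Omega[\alpha+\lambda\psi]_+^p=1$, where $[t]_+=\max\{t,0\}$. *)

theory Defs
  imports "HOL-Analysis.Analysis"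
begin

definition holder_on :: "real \<Rightarrow> 'a::metric_space set \<Rightarrow> ('a \<Rightarrow> 'b::real_normed_vector) \<Rightarrow> bool" where
  "holder_on \<beta> S f \<longleftrightarrow> (\<exists>C. \<forall>x\<in>S. \<forall>y\<in>S. norm (f x - f y) \<le> C * dist x y powr \<beta>)"

definition D1 :: "('a::real_normed_vector \<Rightarrow> 'b::real_normed_vector) \<Rightarrow> 'a \<Rightarrow> 'a \<Rightarrow> 'b" where
  "D1 f x h = frechet_derivative f (at x) h"

definition D2 :: "('a::real_normed_vector \<Rightarrow> 'b::real_normed_vector) \<Rightarrow> 'a \<Rightarrow> 'a \<Rightarrow> 'a \<Rightarrow> 'b" where
  "D2 f x h k = frechet_derivative (\<lambda>y. D1 f y h) (at x) k"

definition laplacian :: "('a::euclidean_space \<Rightarrow> real) \<Rightarrow> 'a \<Rightarrow> real" where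
  "laplacian f x = (\<Sum>b\<in>Basis. D2 f x b b)"

definition C2_holder_on :: "real \<Rightarrow> 'a::euclidean_space set \<Rightarrow> ('a \<Rightarrow> 'b::euclidean_space) \<Rightarrow> bool" where
  "C2_holder_on \<beta> U f \<longleftrightarrow>
     (\<forall>x\<in>U. f differentiable (at x)) \<and>
     (\<forall>h. \<forall>x\<in>U. (\<lambda>y. D1 f y h) differentiable (at x)) \<and>
     bounded (f ` U) \<and>
     (\<forall>h\<in>Basis. bounded ((\<lambda>y. D1 f y h) ` U) \<and> uniformly_continuous_on U (\<lambda>y. D1 f y h)) \<and>
     (\<forall>h\<in>Basis. \<forall>k\<in>Basis. bounded ((\<lambda>y. D2 f y h k) ` U) \<and> holder_on \<beta> U (\<lambda>y. D2 f y h k))"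

definition C2_holder_closure :: "real \<Rightarrow> 'a::euclidean_space set \<Rightarrow> ('a \<Rightarrow> 'b::euclidean_space) \<Rightarrow> bool" where
  "C2_holder_closure \<beta> \<Omega> f \<longleftrightarrow> continuous_on (closure \<Omega>) f \<and> C2_holder_on \<beta> \<Omega> f"

text \<open>Bounded domain of class C^{2,beta} (Gilbarg--Trudinger, Sect. 6.2): each boundary
  point has a ball neighbourhood B and an injective C^{2,beta} map Phi on B, with C^{2,beta}
  inverse on the open set D = Phi(B), flattening the boundary onto a hyperplane.\<close>
definition C2_holder_domain :: "real \<Rightarrow> 'a::euclidean_space set \<Rightarrow> bool" where
  "C2_holder_domain \<beta> \<Omega> \<longleftrightarrow>
     open \<Omega> \<and> connected \<Omega> \<and> \<Omega> \<noteq> {} \<and> bounded \<Omega> \<and>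
     (\<forall>x0\<in>frontier \<Omega>. \<exists>r>0. \<exists>(\<Phi>::'a \<Rightarrow> 'a) e.
        norm e = 1 \<and> inj_on \<Phi> (ball x0 r) \<and> open (\<Phi> ` ball x0 r) \<and>
        C2_holder_on \<beta> (ball x0 r) \<Phi> \<and>
        C2_holder_on \<beta> (\<Phi> ` ball x0 r) (inv_into (ball x0 r) \<Phi>) \<and>
        \<Phi> ` (ball x0 r \<inter> \<Omega>) \<subseteq> {y. y \<bullet> e > 0} \<and>
        \<Phi> ` (ball x0 r \<inter> frontier \<Omega>) \<subseteq> {y. y \<bullet> e = 0})"

definition solves_P :: "real \<Rightarrow> 'a::euclidean_space set \<Rightarrow> real \<Rightarrow> real \<Rightarrow> real \<Rightarrow> ('a \<Rightarrow> real) \<Rightarrow> bool" where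
  "solves_P \<beta> \<Omega> p lam \<alpha> \<psi> \<longleftrightarrow>
     C2_holder_closure \<beta> \<Omega> \<psi> \<and>
     (\<forall>x\<in>\<Omega>. - laplacian \<psi> x = (max (\<alpha> + lam * \<psi> x) 0) powr p) \<and>
     (\<forall>x\<in>frontier \<Omega>. \<psi> x = 0) \<and>
     integral \<Omega> (\<lambda>x. (max (\<alpha> + lam * \<psi> x) 0) powr p) = 1"

end

theory Submission
  imports Defs
begin

text \<open>
  On \<open>\<Omega>\<close> compare \<open>\<psi>\<close> with the potential of \<open>F = [\<alpha> + \<lambda>\<psi>]\<^sub>+\<^sup>p\<close>, which extends by 0 to a
  continuous function because \<open>\<alpha> < 0\<close>. The regularized kernel \<open>(|z|\<^sup>2 + e\<^sup>2)\<close> to the power \<open>(2 - N)/2\<close>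
  has minus its Laplacian concentrated at scale \<open>e\<close>, so for small \<open>e\<close> a multiple of the potential is,
  up to a small error, a supersolution and the maximum principle bounds \<open>\<psi>\<close> by it. If
  \<open>M = max (\<alpha> + \<lambda>\<psi>)\<close>, then \<open>0 \<le> F \<le> M\<^sup>p\<close> and \<open>\<integral>F = 1\<close>; splitting the potential at radius \<open>r\<close> with
  \<open>M\<^sup>p r\<^sup>N = 1\<close> bounds it by \<open>C M\<^sup>q\<close>, where \<open>q = p(N - 2)/N\<close>. At the maximum of \<open>\<psi>\<close> this gives
  \<open>M + |\<alpha>| \<le> \<lambda> C M\<^sup>q\<close>, and \<open>q < 1\<close> makes \<open>|\<alpha>|\<close> bounded as long as \<open>\<lambda>\<close> is.
  The second claim holds because \<open>\<integral>F = 1\<close> forces \<open>\<lambda>\<psi> > |\<alpha>|\<close> somewhere.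

  Potentials are never differentiated under the integral sign: Laplacians are taken as limits of
  second difference quotients, which commute with the integral and suffice at a maximum.
\<close>

subsection \<open>Discrete Laplacians\<close>

text \<open>One application of l'Hopital leaves \<open>(g' h - g' (- h)) / (2 * h)\<close>, the mean
  of the two one-sided difference quotients of \<open>g'\<close> at 0. Hence \<open>g'\<close> has
  to be differentiable only at 0, and no continuity of a second derivative enters.\<close>

lemma second_difference_quotient_tendsto:
  fixes g g' :: "real \<Rightarrow> real"
  assumes g: "eventually (\<lambda>t. (g has_real_derivative g' t) (at t)) (nhds 0)"
    and g': "(g' has_real_derivative l) (at 0)"
  shows "((\<lambda>h. (g h + g (- h) - 2 * g 0) / h\<^sup>2) \<longlongrightarrow> l) (at_right 0)"
proof (rule lhopital_right_0)
  have cont: "isCont g 0"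
    using eventually_nhds_x_imp_x[OF g] DERIV_isCont by blast
  have minus: "((\<lambda>h::real. - h) \<longlongrightarrow> 0) (at_right 0)"
    using tendsto_minus[OF tendsto_ident_at[of 0 "{0<..}"]] by simp
  have "((\<lambda>h. g (- h)) \<longlongrightarrow> g 0) (at_right 0)"
    by (rule isCont_tendsto_compose[OF cont minus])
  moreover have "(g \<longlongrightarrow> g 0) (at_right 0)"
    using cont by (simp add: isCont_def filterlim_at_split)
  ultimately show "((\<lambda>h. g h + g (- h) - 2 * g 0) \<longlongrightarrow> 0) (at_right 0)"
    by (auto intro!: tendsto_eq_intros)
  show "((\<lambda>h::real. h\<^sup>2) \<longlongrightarrow> 0) (at_right 0)"
    by (auto intro!: tendsto_eq_intros)
  show "eventually (\<lambda>h::real. h\<^sup>2 \<noteq> 0) (at_right 0)" "eventually (\<lambda>h::real. 2 * h \<noteq> 0) (at_right 0)"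
    by (auto simp: eventually_at_filter)
  show "eventually (\<lambda>h::real. ((\<lambda>h. h\<^sup>2) has_real_derivative 2 * h) (at h)) (at_right 0)"
    by (auto intro!: always_eventually derivative_eq_intros)
  obtain d where d: "d > 0" "\<And>t. \<bar>t\<bar> < d \<Longrightarrow> (g has_real_derivative g' t) (at t)"
    using g by (auto simp: eventually_nhds_metric dist_real_def)
  have "((\<lambda>h. g h + g (- h) - 2 * g 0) has_real_derivative g' h - g' (- h)) (at h)"
    if "0 < h" "h < d" for h
    using that by (auto intro!: derivative_eq_intros d(2) DERIV_chain2[of g "g' (- h)" uminus])
  then show "eventually (\<lambda>h. ((\<lambda>h. g h + g (- h) - 2 * g 0) has_real_derivative g' h - g' (- h)) (at h))
      (at_right 0)"
    using d(1) by (auto simp: eventually_at_right_field)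
  have l: "((\<lambda>h. (g' h - g' 0) / h) \<longlongrightarrow> l) (at 0)"
    using g' by (simp add: DERIV_def)
  have "((\<lambda>h. (g' h - g' 0) / h) \<longlongrightarrow> l) (at_right 0)"
    using l filterlim_at_split by blast
  moreover have "((\<lambda>h. (g' (- h) - g' 0) / (- h)) \<longlongrightarrow> l) (at_right 0)"
    by (rule tendsto_compose_eventually[OF l minus]) (auto simp: eventually_at_filter)
  ultimately have "((\<lambda>h. ((g' h - g' 0) / h + (g' (- h) - g' 0) / (- h)) / 2) \<longlongrightarrow> l) (at_right 0)"
    using tendsto_divide[OF tendsto_add tendsto_const[of 2]] by force
  then show "((\<lambda>h. (g' h - g' (- h)) / (2 * h)) \<longlongrightarrow> l) (at_right 0)"
    by (rule Lim_transform_eventually) (auto simp: eventually_at_filter field_simps)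
qed

text \<open>Two mean value theorems: one for the even function \<open>g h + g (- h)\<close> on the
  interval from 0 to \<open>h\<close>, one for \<open>g'\<close> on the symmetric interval it
  yields. The bound is uniform in \<open>h\<close> and later serves for domination.\<close>

lemma second_difference_bound:
  fixes g g' g'' :: "real \<Rightarrow> real"
  assumes g: "\<And>t. (g has_real_derivative g' t) (at t)"
    and g': "\<And>t. (g' has_real_derivative g'' t) (at t)"
    and C: "\<And>t. \<bar>g'' t\<bar> \<le> C" and h: "0 < h"
  shows "\<bar>(g h + g (- h) - 2 * g 0) / h\<^sup>2\<bar> \<le> 2 * C"
proof -
  define \<phi> where "\<phi> h = g h + g (- h)" for h
  have "(\<phi> has_real_derivative g' t - g' (- t)) (at t)" for t
    unfolding \<phi>_def
    by (auto intro!: derivative_eq_intros g DERIV_chain2[of g "g' (- t)" uminus])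
  then obtain s where s: "0 < s" "s < h" "\<phi> h - \<phi> 0 = h * (g' s - g' (- s))"
    using MVT2[of 0 h \<phi> "\<lambda>t. g' t - g' (- t)"] h by auto
  obtain r where r: "g' s - g' (- s) = (2 * s) * g'' r"
    using MVT2[of "- s" s g' g''] g' s by auto
  have "\<phi> h - \<phi> 0 = h * ((2 * s) * g'' r)"
    using s r by simp
  then have "\<bar>\<phi> h - \<phi> 0\<bar> = h * ((2 * s) * \<bar>g'' r\<bar>)"
    using h s by (simp add: abs_mult)
  also have "\<dots> \<le> h * ((2 * h) * C)"
    using h s C[of r] by (intro mult_mono) auto
  finally show ?thesis
    using h by (simp add: \<phi>_def divide_le_eq power2_eq_square mult_ac)
qed

text \<open>Along a coordinate line the regularized kernel has this form, with \<open>c\<close>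
  constant and \<open>d + t\<close> the moving coordinate.\<close>

lemma shifted_square_powr_derivative:
  fixes c d s t :: real
  assumes "0 < c"
  shows "((\<lambda>t. (c + (d + t)\<^sup>2) powr s) has_real_derivative
    2 * s * (c + (d + t)\<^sup>2) powr (s - 1) * (d + t)) (at t)"
proof -
  have pos: "0 < c + (d + t)\<^sup>2" using assms by (simp add: add_pos_nonneg)
  show ?thesis
    by (rule DERIV_cong[OF DERIV_fun_powr[where m = "2 * (d + t)"]])
       (use pos in \<open>auto intro!: derivative_eq_intros\<close>)
qed

lemma shifted_square_powr_second_derivative:
  fixes c d s t :: real
  assumes "0 < c"
  shows "((\<lambda>t. 2 * s * (c + (d + t)\<^sup>2) powr (s - 1) * (d + t)) has_real_derivative
    4 * s * (s - 1) * (c + (d + t)\<^sup>2) powr (s - 2) * (d + t)\<^sup>2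
    + 2 * s * (c + (d + t)\<^sup>2) powr (s - 1)) (at t)"
  by (rule DERIV_cong[OF DERIV_mult[OF DERIV_cmult[OF shifted_square_powr_derivative[OF assms]]
        DERIV_add[OF DERIV_const DERIV_ident]]])
     (simp add: algebra_simps power2_eq_square)

section \<open>Discrete Laplacians in several variables\<close>

definition discrete_laplacian :: "real \<Rightarrow> ('a::euclidean_space \<Rightarrow> real) \<Rightarrow> 'a \<Rightarrow> real" where
  "discrete_laplacian h u x = (\<Sum>b\<in>Basis. (u (x + h *\<^sub>R b) + u (x - h *\<^sub>R b) - 2 * u x) / h\<^sup>2)"

text \<open>Restricting \<open>u\<close> to each coordinate line through \<open>x\<close> reduces
  the claim to one variable. First derivatives are needed near \<open>x\<close>, second ones only at
  \<open>x\<close>.\<close>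

lemma discrete_laplacian_tendsto:
  fixes u :: "'a::euclidean_space \<Rightarrow> real"
  assumes "open U" "x \<in> U"
    and d1: "\<And>y. y \<in> U \<Longrightarrow> u differentiable (at y)"
    and d2: "\<And>h. (\<lambda>y. D1 u y h) differentiable (at x)"
  shows "((\<lambda>h. discrete_laplacian h u x) \<longlongrightarrow> laplacian u x) (at_right 0)"
  unfolding discrete_laplacian_def laplacian_def
proof (rule tendsto_sum)
  fix b :: 'a assume b: "b \<in> Basis"
  define g where "g t = u (x + t *\<^sub>R b)" for t
  define g' where "g' t = D1 u (x + t *\<^sub>R b) b" for t
  have "((\<lambda>t. x + t *\<^sub>R b) \<longlongrightarrow> x) (nhds (0::real))"
    by (auto intro!: tendsto_eq_intros filterlim_ident)
  then have "eventually (\<lambda>t. x + t *\<^sub>R b \<in> U) (nhds 0)"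
    using assms(1,2) by (rule topological_tendstoD)
  then have ev: "eventually (\<lambda>t. (g has_real_derivative g' t) (at t)) (nhds 0)"
  proof eventually_elim
    case (elim t)
    have "(u has_derivative D1 u (x + t *\<^sub>R b)) (at (x + t *\<^sub>R b))"
      using d1[OF elim] unfolding D1_def[abs_def] by (simp add: frechet_derivative_works)
    then have "(g has_derivative (\<lambda>s. D1 u (x + t *\<^sub>R b) (s *\<^sub>R b))) (at t)"
      unfolding g_def
      by (rule has_derivative_compose[rotated]) (auto intro!: derivative_eq_intros)
    moreover have "D1 u (x + t *\<^sub>R b) (s *\<^sub>R b) = g' t * s" for s
      using d1[OF elim] unfolding D1_def g'_def
      by (simp add: linear_frechet_derivative linear_scale)
    ultimately show ?case by (simp add: has_field_derivative_def)
  qed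
  have "((\<lambda>y. D1 u y b) has_derivative D2 u x b) (at (x + 0 *\<^sub>R b))"
    using d2 unfolding D2_def[abs_def] by (simp add: frechet_derivative_works)
  then have "(g' has_derivative (\<lambda>s. D2 u x b (s *\<^sub>R b))) (at 0)"
    unfolding g'_def
    by (rule has_derivative_compose[rotated]) (auto intro!: derivative_eq_intros)
  moreover have "D2 u x b (s *\<^sub>R b) = D2 u x b b * s" for s
    using d2 unfolding D2_def by (simp add: linear_frechet_derivative linear_scale)
  ultimately have "(g' has_real_derivative D2 u x b b) (at 0)"
    by (simp add: has_field_derivative_def)
  from second_difference_quotient_tendsto[OF ev this]
  show "((\<lambda>h. (u (x + h *\<^sub>R b) + u (x - h *\<^sub>R b) - 2 * u x) / h\<^sup>2) \<longlongrightarrow> D2 u x b b) (at_right 0)"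
    by (simp add: g_def)
qed

lemma norm_add_scaleR_Basis_square:
  fixes x b :: "'a::euclidean_space"
  assumes "b \<in> Basis"
  shows "(norm (x + t *\<^sub>R b))\<^sup>2 = (norm x)\<^sup>2 + 2 * t * (x \<bullet> b) + t\<^sup>2"
  unfolding power2_norm_eq_inner using assms
  by (simp add: inner_simps inner_commute algebra_simps power2_eq_square)

text \<open>Second differences are exact on quadratics, so this holds for every step and not only in
  the limit. The quadratic later supplies strictness in the maximum principle.\<close>

lemma discrete_laplacian_norm_square:
  fixes x :: "'a::euclidean_space"
  assumes "h \<noteq> 0"
  shows "discrete_laplacian h (\<lambda>x. (norm x)\<^sup>2) x = 2 * real DIM('a)"
proof -
  have "((norm (x + h *\<^sub>R b))\<^sup>2 + (norm (x - h *\<^sub>R b))\<^sup>2 - 2 * (norm x)\<^sup>2) / h\<^sup>2 = 2" if "b \<in> Basis" for b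
    using assms norm_add_scaleR_Basis_square[OF that, of x h]
      norm_add_scaleR_Basis_square[OF that, of x "- h"]
    by (simp add: field_simps)
  then show ?thesis by (simp add: discrete_laplacian_def)
qed

lemma discrete_laplacian_add:
  "discrete_laplacian h (\<lambda>x. u x + v x) x = discrete_laplacian h u x + discrete_laplacian h v x"
  by (simp add: discrete_laplacian_def sum.distrib[symmetric] add_divide_distrib[symmetric] algebra_simps)

lemma discrete_laplacian_cmult:
  "discrete_laplacian h (\<lambda>x. c * u x) x = c * discrete_laplacian h u x"
  by (simp add: discrete_laplacian_def sum_distrib_left algebra_simps)

text \<open>Once the step is smaller than the radius of a ball around \<open>x\<close> inside
  \<open>U\<close>, all the neighbours used lie in \<open>U\<close>, and every second difference is
  nonpositive.\<close>

lemma discrete_laplacian_nonpos_at_max: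
  fixes u :: "'a::euclidean_space \<Rightarrow> real"
  assumes "open U" "x \<in> U" "\<And>y. y \<in> U \<Longrightarrow> u y \<le> u x"
  shows "eventually (\<lambda>h. discrete_laplacian h u x \<le> 0) (at_right 0)"
proof -
  obtain d where d: "d > 0" "ball x d \<subseteq> U"
    using assms(1,2) by (auto simp: open_contains_ball)
  have "discrete_laplacian h u x \<le> 0" if "0 < h" "h < d" for h
    unfolding discrete_laplacian_def
  proof (rule sum_nonpos)
    fix b :: 'a assume "b \<in> Basis"
    then have "x + h *\<^sub>R b \<in> U" "x - h *\<^sub>R b \<in> U"
      using that d(2) by (auto simp: subset_iff dist_norm)
    then show "(u (x + h *\<^sub>R b) + u (x - h *\<^sub>R b) - 2 * u x) / h\<^sup>2 \<le> 0"
      using assms(3)[of "x + h *\<^sub>R b"] assms(3)[of "x - h *\<^sub>R b"]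
      by (intro divide_nonpos_nonneg) auto
  qed
  then show ?thesis
    using d(1) by (auto simp: eventually_at_right_field)
qed

subsection \<open>The regularized Newtonian potential\<close>

text \<open>A smooth superharmonic regularization of the Newtonian kernel \<open>norm z powr (2 - N)\<close>.\<close>

definition newton_kernel :: "real \<Rightarrow> 'a::euclidean_space \<Rightarrow> real" where
  "newton_kernel e z = ((norm z)\<^sup>2 + e\<^sup>2) powr (1 - real DIM('a) / 2)"

section \<open>The kernel along coordinate lines and its Laplacian\<close>

lemma newton_kernel_line:
  fixes z b :: "'a::euclidean_space"
  assumes "b \<in> Basis"
  shows "newton_kernel e (z + t *\<^sub>R b) =
    ((norm z)\<^sup>2 - (z \<bullet> b)\<^sup>2 + e\<^sup>2 + (z \<bullet> b + t)\<^sup>2) powr (1 - real DIM('a) / 2)"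
proof -
  have "(norm (z + t *\<^sub>R b))\<^sup>2 + e\<^sup>2 = (norm z)\<^sup>2 - (z \<bullet> b)\<^sup>2 + e\<^sup>2 + (z \<bullet> b + t)\<^sup>2"
    unfolding norm_add_scaleR_Basis_square[OF assms] by (simp add: power2_sum)
  then show ?thesis by (simp only: newton_kernel_def)
qed

text \<open>The part of the base that stays constant along the line is bounded below by
  \<open>e\<close> squared, uniformly in \<open>z\<close>; this keeps the power away from its
  singularity.\<close>

lemma newton_kernel_line_const:
  fixes z b :: "'a::euclidean_space"
  assumes "b \<in> Basis"
  shows "e\<^sup>2 \<le> (norm z)\<^sup>2 - (z \<bullet> b)\<^sup>2 + e\<^sup>2"
proof -
  have "\<bar>z \<bullet> b\<bar> \<le> norm z" using assms by (simp add: Basis_le_norm)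
  then show ?thesis using power_mono[of "\<bar>z \<bullet> b\<bar>" "norm z" 2] by simp
qed

lemma discrete_laplacian_newton_kernel_tendsto:
  fixes z :: "'a::euclidean_space"
  assumes "0 < e"
  shows "((\<lambda>h. discrete_laplacian h (newton_kernel e) z) \<longlongrightarrow>
    - (real DIM('a) * (real DIM('a) - 2) * e\<^sup>2 * ((norm z)\<^sup>2 + e\<^sup>2) powr (- 1 - real DIM('a) / 2))) (at_right 0)"
proof -
  let ?N = "real DIM('a)"
  define s where "s = 1 - ?N / 2"
  define q where "q = (norm z)\<^sup>2 + e\<^sup>2"
  have q: "q > 0" using assms by (simp add: q_def add_nonneg_pos)
  have "((\<lambda>h. discrete_laplacian h (newton_kernel e) z) \<longlongrightarrow>
      (\<Sum>b\<in>Basis. 4 * s * (s - 1) * q powr (s - 2) * (z \<bullet> b)\<^sup>2 + 2 * s * q powr (s - 1))) (at_right 0)"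
    unfolding discrete_laplacian_def
  proof (rule tendsto_sum)
    fix b :: 'a assume b: "b \<in> Basis"
    define c where "c = (norm z)\<^sup>2 - (z \<bullet> b)\<^sup>2 + e\<^sup>2"
    have c: "0 < c"
      using newton_kernel_line_const[OF b, of e z] zero_less_power[OF assms, of 2]
      unfolding c_def by linarith
    have line: "newton_kernel e (z + t *\<^sub>R b) = (c + (z \<bullet> b + t)\<^sup>2) powr s" for t
      using newton_kernel_line[OF b] by (simp add: c_def s_def)
    have line': "newton_kernel e (z - t *\<^sub>R b) = (c + (z \<bullet> b + - t)\<^sup>2) powr s" for t
      using line[of "- t"] by simp
    have line0: "newton_kernel e z = (c + (z \<bullet> b + 0)\<^sup>2) powr s"
      using line[of 0] by simp
    have cq: "c + (z \<bullet> b)\<^sup>2 = q" by (simp add: c_def q_def)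
    have "((\<lambda>h. ((c + (z \<bullet> b + h)\<^sup>2) powr s + (c + (z \<bullet> b + - h)\<^sup>2) powr s
          - 2 * (c + (z \<bullet> b + 0)\<^sup>2) powr s) / h\<^sup>2) \<longlongrightarrow>
          4 * s * (s - 1) * (c + (z \<bullet> b + 0)\<^sup>2) powr (s - 2) * (z \<bullet> b + 0)\<^sup>2
          + 2 * s * (c + (z \<bullet> b + 0)\<^sup>2) powr (s - 1)) (at_right 0)"
      by (rule second_difference_quotient_tendsto[OF always_eventually
            shifted_square_powr_second_derivative[OF c]])
         (use shifted_square_powr_derivative[OF c] in blast)
    then show "((\<lambda>h. (newton_kernel e (z + h *\<^sub>R b) + newton_kernel e (z - h *\<^sub>R b)
        - 2 * newton_kernel e z) / h\<^sup>2) \<longlongrightarrow>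
        4 * s * (s - 1) * q powr (s - 2) * (z \<bullet> b)\<^sup>2 + 2 * s * q powr (s - 1)) (at_right 0)"
      unfolding line line' line0 by (simp add: cq)
  qed
  also have "(\<Sum>b\<in>Basis. 4 * s * (s - 1) * q powr (s - 2) * (z \<bullet> b)\<^sup>2 + 2 * s * q powr (s - 1))
      = 4 * s * (s - 1) * q powr (s - 2) * (norm z)\<^sup>2 + ?N * (2 * s * q powr (s - 1))"
    unfolding power2_norm_eq_inner euclidean_inner[of z z]
    by (simp add: sum.distrib sum_distrib_left[symmetric] power2_eq_square)
  also have "q powr (s - 1) = q * q powr (s - 2)"
    using q powr_add[of q 1 "s - 2"] by simp
  \<comment> \<open>As \<open>2 * (s - 1)\<close> is minus the dimension, the terms with the square
    of \<open>norm z\<close> cancel, and only the one with the square of \<open>e\<close>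
    survives.\<close>
  also have "4 * s * (s - 1) * q powr (s - 2) * (norm z)\<^sup>2 + ?N * (2 * s * (q * q powr (s - 2)))
      = - (?N * (?N - 2) * e\<^sup>2 * q powr (- 1 - ?N / 2))"
    by (simp add: s_def q_def algebra_simps)
  finally show ?thesis by (simp add: q_def)
qed

text \<open>For fixed \<open>e\<close> the second derivatives along lines are bounded uniformly: the
  square \<open>(d + t)\<^sup>2\<close> is at most the base \<open>q\<close>, so both terms are
  controlled by \<open>q powr (s - 1)\<close>, and \<open>q\<close> is at least the square of
  \<open>e\<close> while the exponent is nonpositive.\<close>

lemma discrete_laplacian_newton_kernel_bound:
  assumes "0 < e"
  obtains C where "\<And>h z. 0 < h \<Longrightarrow> \<bar>discrete_laplacian h (newton_kernel e) (z::'a::euclidean_space)\<bar> \<le> C"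
proof
  let ?N = "real DIM('a)"
  define s where "s = 1 - ?N / 2"
  have s: "s \<le> 1" "s - 1 \<le> 0" by (auto simp: s_def)
  define C where "C = (4 * \<bar>s\<bar> * \<bar>s - 1\<bar> + 2 * \<bar>s\<bar>) * (e\<^sup>2) powr (s - 1)"
  fix h :: real and z :: 'a assume h: "0 < h"
  have "\<bar>discrete_laplacian h (newton_kernel e) z\<bar> \<le> (\<Sum>b\<in>(Basis :: 'a set). 2 * C)"
    unfolding discrete_laplacian_def
  proof (rule order_trans[OF sum_abs sum_mono])
    fix b :: 'a assume b: "b \<in> Basis"
    define c where "c = (norm z)\<^sup>2 - (z \<bullet> b)\<^sup>2 + e\<^sup>2"
    have ce: "e\<^sup>2 \<le> c" using newton_kernel_line_const[OF b] by (simp add: c_def)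
    have e2: "0 < e\<^sup>2" using assms by simp
    have c: "0 < c" using ce e2 by linarith
    have line: "newton_kernel e (z + t *\<^sub>R b) = (c + (z \<bullet> b + t)\<^sup>2) powr s" for t
      using newton_kernel_line[OF b] by (simp add: c_def s_def)
    have line': "newton_kernel e (z - t *\<^sub>R b) = (c + (z \<bullet> b + - t)\<^sup>2) powr s" for t
      using line[of "- t"] by simp
    have line0: "newton_kernel e z = (c + (z \<bullet> b + 0)\<^sup>2) powr s"
      using line[of 0] by simp
    have bound: "\<bar>4 * s * (s - 1) * (c + (d + t)\<^sup>2) powr (s - 2) * (d + t)\<^sup>2
        + 2 * s * (c + (d + t)\<^sup>2) powr (s - 1)\<bar> \<le> C" for d t
    proof -
      define q where "q = c + (d + t)\<^sup>2"
      have q: "e\<^sup>2 \<le> q" "(d + t)\<^sup>2 \<le> q" using ce c by (auto simp: q_def add_increasing2)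
      then have "0 < q" using e2 by linarith
      then have eq: "q powr (s - 1) = q powr (s - 2) * q"
        using powr_add[of q "s - 2" 1] by simp
      have "\<bar>4 * s * (s - 1) * q powr (s - 2) * (d + t)\<^sup>2 + 2 * s * q powr (s - 1)\<bar>
          \<le> 4 * \<bar>s\<bar> * \<bar>s - 1\<bar> * (q powr (s - 2) * (d + t)\<^sup>2) + 2 * \<bar>s\<bar> * q powr (s - 1)"
        by (rule order_trans[OF abs_triangle_ineq]) (simp add: abs_mult)
      also have "\<dots> \<le> 4 * \<bar>s\<bar> * \<bar>s - 1\<bar> * q powr (s - 1) + 2 * \<bar>s\<bar> * q powr (s - 1)"
        unfolding eq using q by (intro add_mono mult_left_mono) auto
      also have "\<dots> = (4 * \<bar>s\<bar> * \<bar>s - 1\<bar> + 2 * \<bar>s\<bar>) * q powr (s - 1)"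
        by (simp add: algebra_simps)
      also have "\<dots> \<le> C"
        unfolding C_def using s q e2 by (intro mult_left_mono powr_mono2') auto
      finally show ?thesis by (simp add: q_def)
    qed
    show "\<bar>(newton_kernel e (z + h *\<^sub>R b) + newton_kernel e (z - h *\<^sub>R b)
        - 2 * newton_kernel e z) / h\<^sup>2\<bar> \<le> 2 * C"
      unfolding line line' line0
      by (rule second_difference_bound[OF shifted_square_powr_derivative[OF c]
            shifted_square_powr_second_derivative[OF c] bound h])
  qed
  then show "\<bar>discrete_laplacian h (newton_kernel e) z\<bar> \<le> (\<Sum>b\<in>(Basis :: 'a set). 2 * C)" .
qed

section \<open>Pointwise bounds for the kernel and its integrals over balls\<close>

lemma lborel_integral_affine:
  fixes f :: "'a::euclidean_space \<Rightarrow> real"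
  assumes [measurable]: "f \<in> borel_measurable borel" and c: "c \<noteq> 0"
  shows "(LINT x|lborel. f x) = \<bar>c\<bar> ^ DIM('a) * (LINT x|lborel. f (t + c *\<^sub>R x))"
  by (subst lborel_affine[OF c, of t], subst integral_real_density)
     (simp_all add: integral_distr)

lemma newton_kernel_nonneg: "0 \<le> newton_kernel e z"
  by (simp add: newton_kernel_def)

lemma borel_measurable_newton_kernel [measurable]: "newton_kernel e \<in> borel_measurable borel"
  unfolding newton_kernel_def[abs_def] by measurable

lemma borel_measurable_indicator_newton_kernel:
  fixes c :: "'a::euclidean_space"
  shows "(\<lambda>z. indicator (cball c r) z * newton_kernel e z :: real) \<in> borel_measurable borel"
  by (intro borel_measurable_times borel_measurable_indicator borel_closed borel_measurable_newton_kernel)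
     auto

lemma continuous_on_newton_kernel:
  assumes "0 < e" "continuous_on S f"
  shows "continuous_on S (\<lambda>x. newton_kernel e (f x :: 'a::euclidean_space))"
proof -
  have "(norm z)\<^sup>2 + e\<^sup>2 \<noteq> 0" for z :: 'a
    using assms(1) by (simp add: sum_power2_eq_zero_iff)
  then show ?thesis
    unfolding newton_kernel_def using assms by (intro continuous_intros) auto
qed

text \<open>The bound is free of \<open>e\<close>, because the exponent is negative and adding the
  square of \<open>e\<close> only enlarges the base.\<close>

lemma newton_kernel_le:
  fixes z :: "'a::euclidean_space"
  assumes "DIM('a) \<ge> 3" "0 < r" "r \<le> norm z"
  shows "newton_kernel e z \<le> r powr (2 - real DIM('a))"
proof -
  have "r\<^sup>2 \<le> (norm z)\<^sup>2 + e\<^sup>2"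
    using assms power_mono[of r "norm z" 2] by (simp add: add_increasing2)
  then have "newton_kernel e z \<le> (r\<^sup>2) powr (1 - real DIM('a) / 2)"
    unfolding newton_kernel_def using assms by (intro powr_mono2') auto
  also have "\<dots> = r powr (2 - real DIM('a))"
    using assms powr_powr[of r 2 "1 - real DIM('a) / 2"] by (simp add: algebra_simps)
  finally show ?thesis .
qed

lemma abs_newton_kernel_le_0:
  fixes z :: "'a::euclidean_space"
  assumes "DIM('a) \<ge> 3" "0 < e"
  shows "\<bar>newton_kernel e z\<bar> \<le> newton_kernel e (0::'a)"
proof -
  have "newton_kernel e z \<le> newton_kernel e (0::'a)"
    unfolding newton_kernel_def using assms by (intro powr_mono2') auto
  then show ?thesis by (simp add: newton_kernel_nonneg)
qed

text \<open>The integral \<open>J r\<close> over the ball of radius \<open>r\<close> is self-similar, \<open>J (r / 2) \<le> J r / 4\<close>, and the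
  kernel is bounded on the remaining annulus; so no polar coordinates are needed.\<close>

lemma newton_kernel_integral_cball_le:
  assumes dim: "DIM('a::euclidean_space) \<ge> 3" and r: "0 < r" and e: "0 < e"
  shows "(LINT z|lborel. indicator (cball (0::'a) r) z * newton_kernel e z)
    \<le> 4 / 3 * 2 powr (real DIM('a) - 2) * measure lborel (cball (0::'a) 1) * r\<^sup>2"
proof -
  let ?N = "real DIM('a)"
  define J where "J r e = (LINT z|lborel. indicator (cball (0::'a) r) z * newton_kernel e z)" for r e
  have int: "integrable lborel (\<lambda>z. indicator (cball (0::'a) r) z * newton_kernel e z)"
    if "0 < e" for r e :: real
    using borel_integrable_compact[OF compact_cball continuous_on_newton_kernel[OF that continuous_on_id]]
    by simp
  have ind: "integrable lborel (indicator (cball (0::'a) r) :: 'a \<Rightarrow> real)"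
    by (intro integrable_real_indicator emeasure_lborel_cball_finite) simp
  have ball: "measure lborel (cball (0::'a) r) = r ^ DIM('a) * measure lborel (cball (0::'a) 1)"
    using content_ball_conv_unit_ball[of r "0::'a"] r by (simp add: content_cball_conv_ball)
  have "J (r / 2) e = \<bar>1 / 2\<bar> ^ DIM('a)
      * (LINT z|lborel. indicator (cball (0::'a) (r / 2)) (0 + (1/2) *\<^sub>R z) * newton_kernel e (0 + (1/2) *\<^sub>R z))"
    unfolding J_def
    by (rule lborel_integral_affine[OF borel_measurable_indicator_newton_kernel]) simp
  also have "\<dots> = (LINT z|lborel. (1 / 2) ^ DIM('a) * (indicator (cball (0::'a) (r / 2)) ((1/2) *\<^sub>R z)
      * newton_kernel e ((1/2) *\<^sub>R z)))"
    by simp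
  \<comment> \<open>Halving the variable doubles the regularization parameter. The Jacobian and the
    homogeneity of the kernel, of degree 2 minus the dimension, combine to the factor 1/4.\<close>
  also have "\<dots> = (LINT z|lborel. 1 / 4 * (indicator (cball (0::'a) r) z * newton_kernel (2 * e) z))"
  proof (intro Bochner_Integration.integral_cong refl)
    fix z :: 'a
    have pos: "0 < (norm z)\<^sup>2 + (2 * e)\<^sup>2"
      using e by (simp add: add_nonneg_pos)
    have "newton_kernel e ((1/2) *\<^sub>R z) = (((norm z)\<^sup>2 + (2 * e)\<^sup>2) * (1 / 4)) powr (1 - ?N / 2)"
      by (simp add: newton_kernel_def power2_eq_square algebra_simps)
    also have "\<dots> = newton_kernel (2 * e) z * (1 / 4) powr (1 - ?N / 2)"
      using pos unfolding newton_kernel_def by (subst powr_mult) auto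
    also have "(1 / 4 :: real) powr (1 - ?N / 2) = ((1 / 2) powr 2) powr (1 - ?N / 2)"
      by (simp add: power2_eq_square)
    also have "\<dots> = (1 / 2) powr (2 - ?N)"
      by (simp only: powr_powr) (simp add: algebra_simps)
    finally have "(1 / 2) ^ DIM('a) * newton_kernel e ((1/2) *\<^sub>R z)
        = newton_kernel (2 * e) z * ((1 / 2) powr (2 - ?N) * (1 / 2) powr ?N)"
      by (simp add: powr_realpow)
    also have "(1 / 2 :: real) powr (2 - ?N) * (1 / 2) powr ?N = 1 / 4"
      by (simp add: powr_add[symmetric] power2_eq_square)
    finally show "(1 / 2) ^ DIM('a) * (indicator (cball (0::'a) (r / 2)) ((1/2) *\<^sub>R z)
        * newton_kernel e ((1/2) *\<^sub>R z))
      = 1 / 4 * (indicator (cball 0 r) z * newton_kernel (2 * e) z)"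
      by (auto simp: indicator_def)
  qed
  \<comment> \<open>The kernel decreases in \<open>e\<close>, so the parameter \<open>2 * e\<close>
    may be replaced by \<open>e\<close>.\<close>
  also have "\<dots> \<le> (LINT z|lborel. 1 / 4 * (indicator (cball (0::'a) r) z * newton_kernel e z))"
  proof (intro integral_mono integrable_mult_right int mult_left_mono)
    fix z :: 'a
    show "newton_kernel (2 * e) z \<le> newton_kernel e z"
      unfolding newton_kernel_def
      using dim e by (intro powr_mono2') (auto simp: add_nonneg_pos)
  qed (use e in auto)
  also have "\<dots> = J r e / 4" by (simp add: J_def)
  finally have half: "J (r / 2) e \<le> J r e / 4" .
  have "J r e \<le> (LINT z|lborel. indicator (cball (0::'a) (r / 2)) z * newton_kernel e z
      + (r / 2) powr (2 - ?N) * indicator (cball (0::'a) r) z)"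
    unfolding J_def
  proof (intro integral_mono int e)
    show "integrable lborel (\<lambda>z. indicator (cball (0::'a) (r / 2)) z * newton_kernel e z
        + (r / 2) powr (2 - ?N) * indicator (cball (0::'a) r) z)"
      by (intro Bochner_Integration.integrable_add integrable_mult_right int ind e)
    fix z :: 'a
    show "indicator (cball 0 r) z * newton_kernel e z \<le> indicator (cball 0 (r / 2)) z * newton_kernel e z
        + (r / 2) powr (2 - ?N) * indicator (cball 0 r) z"
      using newton_kernel_le[OF dim, of "r / 2" z e] r newton_kernel_nonneg[of e z]
      by (auto simp: indicator_def)
  qed
  also have "\<dots> = J (r / 2) e + (r / 2) powr (2 - ?N) * measure lborel (cball (0::'a) r)"
    unfolding J_def using int[OF e] ind by simp
  also have "(r / 2) powr (2 - ?N) * measure lborel (cball (0::'a) r)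
      = 2 powr (?N - 2) * measure lborel (cball (0::'a) 1) * r\<^sup>2"
  proof -
    have "(r / 2) powr (2 - ?N) = 2 powr (?N - 2) * r powr (2 - ?N)"
      using r powr_minus[of 2 "2 - ?N"] by (simp add: powr_divide field_simps)
    moreover have "r powr (2 - ?N) * r ^ DIM('a) = r\<^sup>2"
      using r powr_add[of r "2 - ?N" ?N] by (simp add: powr_realpow)
    moreover have "a * b * (c * d) = a * d * (b * c)" for a b c d :: real
      by (simp only: mult_ac)
    ultimately show ?thesis
      unfolding ball by simp
  qed
  \<comment> \<open>From \<open>J r e \<le> J r e / 4 + B\<close> follows
    \<open>J r e \<le> 4 / 3 * B\<close>; this is the source of the constant 4/3.\<close>
  finally show ?thesis using half unfolding J_def[symmetric] by simp
qed

section \<open>Potentials of integrable densities\<close>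

definition newton_potential :: "real \<Rightarrow> ('a::euclidean_space \<Rightarrow> real) \<Rightarrow> 'a \<Rightarrow> real" where
  "newton_potential e F x = (LINT y|lborel. F y * newton_kernel e (x - y))"

lemma integrable_mult_bounded_continuous:
  fixes F k :: "'a::euclidean_space \<Rightarrow> real"
  assumes F: "integrable lborel F" and k: "continuous_on UNIV k" "\<And>y. \<bar>k y\<bar> \<le> C"
  shows "integrable lborel (\<lambda>y. F y * k y)"
proof (rule Bochner_Integration.integrable_bound)
  show "integrable lborel (\<lambda>y. C * F y)" using F by simp
  have "k \<in> borel_measurable borel" using k(1) by (rule borel_measurable_continuous_onI)
  then show "(\<lambda>y. F y * k y) \<in> borel_measurable lborel" using F by simp
  have "\<bar>F y\<bar> * \<bar>k y\<bar> \<le> \<bar>C\<bar> * \<bar>F y\<bar>" for y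
    using mult_left_mono[of "\<bar>k y\<bar>" "\<bar>C\<bar>" "\<bar>F y\<bar>"] k(2)[of y] by (simp add: mult.commute)
  then show "AE y in lborel. norm (F y * k y) \<le> norm (C * F y)"
    by (simp add: abs_mult)
qed

lemma integrable_newton_potential:
  fixes F :: "'a::euclidean_space \<Rightarrow> real"
  assumes "DIM('a) \<ge> 3" "0 < e" "integrable lborel F"
  shows "integrable lborel (\<lambda>y. F y * newton_kernel e (x - y))"
  by (rule integrable_mult_bounded_continuous[where C = "newton_kernel e (0::'a)"])
     (use assms in \<open>auto intro!: continuous_on_newton_kernel continuous_intros abs_newton_kernel_le_0\<close>)

lemma newton_potential_nonneg:
  assumes "\<And>y. 0 \<le> F y"
  shows "0 \<le> newton_potential e F x"
  unfolding newton_potential_def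
  by (intro integral_nonneg_AE) (simp add: assms newton_kernel_nonneg)

text \<open>Near \<open>x\<close> the density is at most \<open>K\<close> and the kernel integral is
  of order \<open>r\<close> squared; farther away the kernel is at most
  \<open>r powr (2 - N)\<close>, \<open>N\<close> being the dimension, and the mass is at most 1.
  The choice \<open>K * r ^ N = 1\<close> balances both parts. The constant is independent of
  \<open>e\<close>.\<close>

lemma newton_potential_le:
  fixes F :: "'a::euclidean_space \<Rightarrow> real"
  assumes dim: "DIM('a) \<ge> 3" and e: "0 < e" and K: "0 < K"
    and F: "integrable lborel F" "\<And>y. 0 \<le> F y" "\<And>y. F y \<le> K" "(LINT y|lborel. F y) \<le> 1"
  shows "newton_potential e F x
    \<le> (4 / 3 * 2 powr (real DIM('a) - 2) * measure lborel (cball (0::'a) 1) + 1) * K powr (1 - 2 / real DIM('a))"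
proof -
  let ?N = "real DIM('a)"
  define A where "A = 4 / 3 * 2 powr (?N - 2) * measure lborel (cball (0::'a) 1)"
  define r where "r = K powr (- 1 / ?N)"
  have r: "0 < r" using K by (simp add: r_def)
  define B where "B z = indicator (cball (0::'a) r) z * newton_kernel e z" for z :: 'a
  have Bm [measurable]: "B \<in> borel_measurable borel"
    unfolding B_def[abs_def] by (rule borel_measurable_indicator_newton_kernel)
  \<comment> \<open>The affine substitution with factor -1 and shift \<open>x\<close> is the
    reflection of \<open>y\<close> to \<open>x - y\<close>.\<close>
  have Bshift: "(LINT y|lborel. B (x - y)) = (LINT z|lborel. B z)"
    using lborel_integral_affine[OF Bm, of "-1" x] by simp
  have Bint: "integrable lborel (\<lambda>y. B (x - y))"
  proof -
    have "integrable lborel (\<lambda>y. indicator (cball x r) y *\<^sub>R newton_kernel e (x - y))"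
      by (intro borel_integrable_compact continuous_on_newton_kernel continuous_intros e) auto
    moreover have "indicator (cball x r) y *\<^sub>R newton_kernel e (x - y) = B (x - y)" for y
      by (auto simp: B_def indicator_def dist_norm norm_minus_commute)
    ultimately show ?thesis by simp
  qed
  have "newton_potential e F x \<le> (LINT y|lborel. K * B (x - y) + r powr (2 - ?N) * F y)"
    unfolding newton_potential_def
  proof (intro integral_mono integrable_newton_potential dim e F(1)
      Bochner_Integration.integrable_add integrable_mult_right Bint)
    fix y
    show "F y * newton_kernel e (x - y) \<le> K * B (x - y) + r powr (2 - ?N) * F y"
    proof (cases "norm (x - y) \<le> r")
      case True
      then have "F y * newton_kernel e (x - y) \<le> K * B (x - y)"
        by (simp add: B_def mult_right_mono F newton_kernel_nonneg)
      then show ?thesis using F(2)[of y] by (simp add: add_increasing2)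
    next
      case False
      then have "F y * newton_kernel e (x - y) \<le> r powr (2 - ?N) * F y"
        using mult_left_mono[OF newton_kernel_le[OF dim r, of "x - y" e] F(2)[of y]]
        by (simp add: mult.commute)
      then show ?thesis using False by (simp add: B_def)
    qed
  qed
  also have "\<dots> = K * (LINT z|lborel. B z) + r powr (2 - ?N) * (LINT y|lborel. F y)"
    using Bint F(1) by (simp add: Bshift)
  also have "\<dots> \<le> K * (A * r\<^sup>2) + r powr (2 - ?N) * 1"
    using newton_kernel_integral_cball_le[OF dim r e] K F(4)
    by (intro add_mono mult_left_mono) (auto simp: A_def B_def)
  also have "r\<^sup>2 = K powr (- 2 / ?N)"
    using K powr_powr[of K "- 1 / ?N" 2] by (simp add: r_def)
  also have "r powr (2 - ?N) = K powr (1 - 2 / ?N)"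
  proof -
    have "- 1 / ?N * (2 - ?N) = 1 - 2 / ?N" using dim by (simp add: field_simps)
    then show ?thesis by (simp only: r_def powr_powr)
  qed
  also have "K * (A * K powr (- 2 / ?N)) = A * K powr (1 - 2 / ?N)"
    using K powr_add[of K 1 "- 2 / ?N"] by simp
  finally show ?thesis by (simp add: A_def algebra_simps)
qed

lemma discrete_laplacian_newton_potential:
  fixes F :: "'a::euclidean_space \<Rightarrow> real"
  assumes "DIM('a) \<ge> 3" "0 < e" "integrable lborel F"
  shows "discrete_laplacian h (newton_potential e F) x
    = (LINT y|lborel. F y * discrete_laplacian h (newton_kernel e) (x - y))"
proof -
  note int = integrable_newton_potential[OF assms]
  have "(LINT y|lborel. F y * discrete_laplacian h (newton_kernel e) (x - y))
    = (LINT y|lborel. (\<Sum>b\<in>Basis. (F y * newton_kernel e (x + h *\<^sub>R b - y)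
        + F y * newton_kernel e (x - h *\<^sub>R b - y) - 2 * (F y * newton_kernel e (x - y))) / h\<^sup>2))"
    by (intro Bochner_Integration.integral_cong refl)
       (simp add: discrete_laplacian_def sum_distrib_left algebra_simps)
  also have "\<dots> = discrete_laplacian h (newton_potential e F) x"
    unfolding discrete_laplacian_def newton_potential_def
    by (subst Bochner_Integration.integral_sum)
       (auto intro!: sum.cong int integrable_divide Bochner_Integration.integrable_diff
          Bochner_Integration.integrable_add integrable_mult_right simp: int
          Bochner_Integration.integral_diff Bochner_Integration.integral_add)
  finally show ?thesis by simp
qed

text \<open>The kernel's discrete Laplacians are bounded uniformly in step and position, so a
  multiple of the absolute value of \<open>F\<close> dominates. The steps form a sequence, as
  dominated convergence requires.\<close>

lemma discrete_laplacian_newton_potential_tendsto: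
  fixes F :: "'a::euclidean_space \<Rightarrow> real"
  assumes "DIM('a) \<ge> 3" and e: "0 < e" and F: "integrable lborel F"
    and h: "filterlim h (at_right 0) sequentially" "\<And>n. 0 < h n"
  shows "(\<lambda>n::nat. discrete_laplacian (h n) (newton_potential e F) x) \<longlonglongrightarrow>
    - (LINT y|lborel. F y * (real DIM('a) * (real DIM('a) - 2) * e\<^sup>2 *
        ((norm (x - y))\<^sup>2 + e\<^sup>2) powr (- 1 - real DIM('a) / 2)))"
proof -
  let ?k = "\<lambda>z::'a. real DIM('a) * (real DIM('a) - 2) * e\<^sup>2 *
        ((norm z)\<^sup>2 + e\<^sup>2) powr (- 1 - real DIM('a) / 2)"
  obtain C where C: "\<And>h z. 0 < h \<Longrightarrow> \<bar>discrete_laplacian h (newton_kernel e) (z::'a)\<bar> \<le> C"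
    using discrete_laplacian_newton_kernel_bound[OF e] by blast
  have kpos: "(norm z)\<^sup>2 + e\<^sup>2 \<noteq> 0" for z :: 'a
    using e by (simp add: sum_power2_eq_zero_iff)
  have Fm [measurable]: "F \<in> borel_measurable borel" using F by auto
  have "(\<lambda>n. LINT y|lborel. F y * discrete_laplacian (h n) (newton_kernel e) (x - y))
      \<longlonglongrightarrow> (LINT y|lborel. F y * (- ?k (x - y)))"
  proof (rule integral_dominated_convergence[where w = "\<lambda>y. \<bar>F y\<bar> * C"])
    show "(\<lambda>y. F y * (- ?k (x - y))) \<in> borel_measurable lborel"
      using kpos by (intro borel_measurable_times)
        (auto intro!: borel_measurable_continuous_onI continuous_intros)
    show "(\<lambda>y. F y * discrete_laplacian (h n) (newton_kernel e) (x - y)) \<in> borel_measurable lborel" for n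
      unfolding discrete_laplacian_def using h(2)[of n]
      by (intro borel_measurable_times)
        (auto intro!: borel_measurable_continuous_onI continuous_intros continuous_on_newton_kernel e)
    show "integrable lborel (\<lambda>y. \<bar>F y\<bar> * C)" using F by auto
    show "AE y in lborel. norm (F y * discrete_laplacian (h n) (newton_kernel e) (x - y)) \<le> \<bar>F y\<bar> * C" for n
      using C[OF h(2)] by (auto simp: abs_mult intro!: mult_left_mono)
    show "AE y in lborel. (\<lambda>n. F y * discrete_laplacian (h n) (newton_kernel e) (x - y))
        \<longlonglongrightarrow> F y * (- ?k (x - y))"
      by (intro AE_I2 tendsto_mult tendsto_const
          filterlim_compose[OF discrete_laplacian_newton_kernel_tendsto[OF e] h(1)])
  qed
  then show ?thesis
    by (simp add: discrete_laplacian_newton_potential[OF assms(1,2,3)])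
qed

text \<open>Dominated convergence again: regularization makes the kernel continuous and bounded by
  its value at the origin.\<close>

lemma continuous_on_newton_potential:
  fixes F :: "'a::euclidean_space \<Rightarrow> real"
  assumes "DIM('a) \<ge> 3" and e: "0 < e" and F: "integrable lborel F"
  shows "continuous_on S (newton_potential e F)"
proof (rule continuous_on_subset[OF _ subset_UNIV])
  have [measurable]: "F \<in> borel_measurable borel" using F by auto
  have meas: "(\<lambda>y. newton_kernel e (x - y)) \<in> borel_measurable borel" for x :: 'a
    by (intro borel_measurable_continuous_onI continuous_on_newton_kernel continuous_intros e)
  show "continuous_on UNIV (newton_potential e F)"
    unfolding continuous_on_sequentially
  proof safe
    fix X :: "nat \<Rightarrow> 'a" and x assume X: "X \<longlonglongrightarrow> x"
    show "(newton_potential e F \<circ> X) \<longlonglongrightarrow> newton_potential e F x"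
      unfolding newton_potential_def comp_def
    proof (rule integral_dominated_convergence[where w = "\<lambda>y. \<bar>F y\<bar> * newton_kernel e (0::'a)"])
      show "AE y in lborel. (\<lambda>n. F y * newton_kernel e (X n - y)) \<longlonglongrightarrow> F y * newton_kernel e (x - y)"
      proof (intro AE_I2 tendsto_mult tendsto_const)
        fix y
        have "continuous_on UNIV (newton_kernel e :: 'a \<Rightarrow> real)"
          using continuous_on_newton_kernel[OF e continuous_on_id] by simp
        then show "(\<lambda>n. newton_kernel e (X n - y)) \<longlonglongrightarrow> newton_kernel e (x - y)"
          by (rule continuous_on_tendsto_compose) (auto intro!: tendsto_intros X)
      qed
      show "AE y in lborel. norm (F y * newton_kernel e (X n - y)) \<le> \<bar>F y\<bar> * newton_kernel e (0::'a)" for n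
        by (auto simp: abs_mult intro!: mult_left_mono abs_newton_kernel_le_0[OF assms(1,2)])
    qed (use F meas in auto)
  qed
qed

text \<open>On the ball of radius \<open>e\<close> the density is at least its value at distance
  \<open>e\<close>, which is of order \<open>e powr (- N)\<close> in dimension \<open>N\<close>; the
  volume of the ball cancels this power, so the lower bound is free of \<open>e\<close>.\<close>

lemma newton_density_lower_bound:
  fixes F :: "'a::euclidean_space \<Rightarrow> real"
  assumes dim: "DIM('a) \<ge> 3" and e: "0 < e"
    and F: "integrable lborel F" "\<And>y. 0 \<le> F y" "\<And>y. y \<in> cball x e \<Longrightarrow> t \<le> F y"
  shows "t * (real DIM('a) * (real DIM('a) - 2) * 2 powr (- 1 - real DIM('a) / 2) * measure lborel (cball (0::'a) 1))
    \<le> (LINT y|lborel. F y * (real DIM('a) * (real DIM('a) - 2) * e\<^sup>2 *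
        ((norm (x - y))\<^sup>2 + e\<^sup>2) powr (- 1 - real DIM('a) / 2)))"
    (is "_ \<le> (LINT y|lborel. F y * ?k y)")
\<comment> \<open>The lemma is applied with \<open>t\<close> slightly below a value of
  \<open>F\<close>, possibly negative; then the left side is nonpositive and the right side is
  nonnegative.\<close>
proof (cases "0 \<le> t")
  case False
  have "0 \<le> (LINT y|lborel. F y * ?k y)"
    using dim by (intro integral_nonneg_AE) (simp add: F)
  moreover have "t * (real DIM('a) * (real DIM('a) - 2) * 2 powr (- 1 - real DIM('a) / 2)
      * measure lborel (cball (0::'a) 1)) \<le> 0"
    using False dim by (intro mult_nonpos_nonneg) auto
  ultimately show ?thesis by linarith
next
  case True
  let ?N = "real DIM('a)"
  let ?s = "- 1 - ?N / 2"
  define k0 where "k0 = ?N * (?N - 2) * e\<^sup>2 * (e\<^sup>2 + e\<^sup>2) powr ?s"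
  have k0: "k0 \<le> ?k y" if "y \<in> cball x e" for y
  proof -
    have "(norm (x - y))\<^sup>2 \<le> e\<^sup>2"
      using that by (intro power_mono) (auto simp: dist_norm)
    then have "(e\<^sup>2 + e\<^sup>2) powr ?s \<le> ((norm (x - y))\<^sup>2 + e\<^sup>2) powr ?s"
      using e by (intro powr_mono2') (auto simp: add_nonneg_pos)
    then show ?thesis
      unfolding k0_def using dim by (intro mult_left_mono) auto
  qed
  have "(e\<^sup>2 + e\<^sup>2) powr ?s = 2 powr ?s * (e\<^sup>2) powr ?s"
    using powr_mult[of 2 "e\<^sup>2" ?s] by simp
  also have "(e\<^sup>2) powr ?s = e powr (- 2 - ?N)"
    using e powr_powr[of e 2 ?s] by (simp add: algebra_simps)
  finally have pk: "(e\<^sup>2 + e\<^sup>2) powr ?s = 2 powr ?s * e powr (- 2 - ?N)" .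
  have pe: "e\<^sup>2 * e powr (- 2 - ?N) * e ^ DIM('a) = 1"
  proof -
    have "e powr 2 * e powr (- 2 - ?N) * e powr ?N = 1"
      using e by (simp only: powr_add[symmetric]) simp
    then show ?thesis using e by (simp add: powr_realpow)
  qed
  have ball: "measure lborel (cball x e) = e ^ DIM('a) * measure lborel (cball (0::'a) 1)"
    using content_ball_conv_unit_ball[of e x] e by (simp add: content_cball_conv_ball)
  have ind: "integrable lborel (indicator (cball x e) :: 'a \<Rightarrow> real)"
    by (intro integrable_real_indicator emeasure_lborel_cball_finite) simp
  have kcont: "continuous_on UNIV ?k"
    using e by (intro continuous_intros) (auto simp: sum_power2_eq_zero_iff)
  have kbound: "\<bar>?k y\<bar> \<le> ?N * (?N - 2) * e\<^sup>2 * (e\<^sup>2) powr ?s" for y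
  proof -
    have "((norm (x - y))\<^sup>2 + e\<^sup>2) powr ?s \<le> (e\<^sup>2) powr ?s"
      using e by (intro powr_mono2') auto
    then have "?k y \<le> ?N * (?N - 2) * e\<^sup>2 * (e\<^sup>2) powr ?s"
      using dim by (intro mult_left_mono) auto
    moreover have "0 \<le> ?k y" using dim by simp
    ultimately show ?thesis by simp
  qed
  have "t * (?N * (?N - 2) * 2 powr ?s * measure lborel (cball (0::'a) 1))
      = t * (?N * (?N - 2) * 2 powr ?s * measure lborel (cball (0::'a) 1))
        * (e\<^sup>2 * e powr (- 2 - ?N) * e ^ DIM('a))"
    by (simp only: pe mult_1_right)
  also have "\<dots> = t * k0 * measure lborel (cball x e)"
    unfolding k0_def pk ball by (simp only: mult_ac)
  also have "\<dots> = (LINT y|lborel. t * k0 * indicator (cball x e) y)"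
    by simp
  also have "\<dots> \<le> (LINT y|lborel. F y * ?k y)"
  proof (intro integral_mono integrable_mult_right ind integrable_mult_bounded_continuous[OF F(1) kcont kbound])
    fix y
    show "t * k0 * indicator (cball x e) y \<le> F y * ?k y"
    proof (cases "y \<in> cball x e")
      case True
      have "0 \<le> k0" using dim by (simp add: k0_def)
      then have "t * k0 \<le> F y * ?k y"
        using F(3)[OF True] k0[OF True] \<open>0 \<le> t\<close> F(2)[of y] by (intro mult_mono) auto
      then show ?thesis using True by simp
    next
      case False
      moreover have "0 \<le> F y * ?k y" using F(2)[of y] dim by simp
      ultimately show ?thesis by simp
    qed
  qed
  finally show ?thesis .
qed

subsection \<open>Comparison\<close>

text \<open>Dividing the potential by the constant of \<open>newton_density_lower_bound\<close>
  makes it a supersolution up to the oscillation of \<open>F\<close> at scale \<open>e\<close>. A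
  small multiple of the squared norm absorbs that error and makes the inequality strict; its size on
  \<Omega> is the loss \<delta>.\<close>

lemma subsolution_le_newton_potential:
  fixes F u :: "'a::euclidean_space \<Rightarrow> real"
  assumes dim: "DIM('a) \<ge> 3"
    and \<Omega>: "open \<Omega>" "bounded \<Omega>"
    and u: "continuous_on (closure \<Omega>) u" "\<And>x. x \<in> \<Omega> \<Longrightarrow> u differentiable (at x)"
      "\<And>h x. x \<in> \<Omega> \<Longrightarrow> (\<lambda>y. D1 u y h) differentiable (at x)"
    and lap: "\<And>x. x \<in> \<Omega> \<Longrightarrow> - laplacian u x \<le> F x"
    and bdry: "\<And>x. x \<in> frontier \<Omega> \<Longrightarrow> u x \<le> 0"
    and F: "integrable lborel F" "continuous_on UNIV F" "\<And>y. 0 \<le> F y"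
    and \<delta>: "0 < \<delta>" and x: "x \<in> closure \<Omega>"
  obtains e where "0 < e" "u x \<le> newton_potential e F x / (real DIM('a) * (real DIM('a) - 2)
    * 2 powr (- 1 - real DIM('a) / 2) * measure lborel (cball (0::'a) 1)) + \<delta>"
proof -
  define c where "c = real DIM('a) * (real DIM('a) - 2)
    * 2 powr (- 1 - real DIM('a) / 2) * measure lborel (cball (0::'a) 1)"
  have c: "0 < c"
    unfolding c_def using dim content_ball_gt_0_iff[of "0::'a" 1]
    by (simp add: content_cball_conv_ball)
  obtain R where R: "0 < R" "\<And>y. y \<in> closure \<Omega> \<Longrightarrow> norm y \<le> R"
    using bounded_closure[OF \<Omega>(2)] unfolding bounded_pos by blast
  define a where "a = \<delta> / R\<^sup>2"
  have a: "0 < a" "a * R\<^sup>2 = \<delta>" using \<delta> R(1) by (auto simp: a_def)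
  \<comment> \<open>Balls of radius \<open>e\<close>, at most 1, around points of the closure stay
    inside the ball of radius \<open>R + 1\<close>.\<close>
  have "uniformly_continuous_on (cball 0 (R + 1)) F"
    by (rule compact_uniformly_continuous[OF continuous_on_subset[OF F(2)]]) auto
  then obtain d where d: "0 < d"
    "\<And>y z. y \<in> cball 0 (R + 1) \<Longrightarrow> z \<in> cball 0 (R + 1) \<Longrightarrow> dist z y < d \<Longrightarrow> dist (F z) (F y) < a"
    using a(1) unfolding uniformly_continuous_on_def by metis
  define e where "e = min 1 (d / 2)"
  have e: "0 < e" "e \<le> 1" "e < d" using d(1) by (auto simp: e_def)
  have Fclose: "F z - a \<le> F y" if "z \<in> closure \<Omega>" "y \<in> cball z e" for y z
  proof -
    have "norm y \<le> norm z + dist z y"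
      using norm_triangle_sub[of y z] by (simp add: dist_norm norm_minus_commute)
    then have "dist (F z) (F y) < a"
      using R(2)[OF that(1)] that(2) e by (intro d(2)) auto
    then show ?thesis by (simp add: dist_real_def)
  qed
  define w where "w y = u y + ((- 1 / c) * newton_potential e F y + a * (norm y)\<^sup>2)" for y
  have "continuous_on (closure \<Omega>) w"
    unfolding w_def[abs_def]
    by (intro continuous_intros u(1) continuous_on_newton_potential[OF dim e(1) F(1)])
  moreover have "compact (closure \<Omega>)" using \<Omega>(2) by (simp add: compact_closure)
  moreover have "closure \<Omega> \<noteq> {}" using x by auto
  ultimately obtain z where z: "z \<in> closure \<Omega>" "\<And>y. y \<in> closure \<Omega> \<Longrightarrow> w y \<le> w z"
    using continuous_attains_sup[of "closure \<Omega>" w] by blast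
  \<comment> \<open>At an interior maximum of \<open>w\<close> the limit of its discrete Laplacians
    is nonpositive. Yet it is at least \<open>- F z + (F z - a) + 2 * N * a\<close>, in dimension
    \<open>N\<close>, which is positive.\<close>
  have "z \<notin> \<Omega>"
  proof
    assume z\<Omega>: "z \<in> \<Omega>"
    define h where "h n = inverse (real (Suc n))" for n
    have h: "0 < h n" for n by (simp add: h_def)
    have hlim: "filterlim h (at_right 0) sequentially"
      unfolding filterlim_at using LIMSEQ_inverse_real_of_nat by (simp add: h_def[abs_def])
    define L where "L = (LINT y|lborel. F y * (real DIM('a) * (real DIM('a) - 2) * e\<^sup>2 *
        ((norm (z - y))\<^sup>2 + e\<^sup>2) powr (- 1 - real DIM('a) / 2)))"
    have "(\<lambda>n. discrete_laplacian (h n) u z + ((- 1 / c) * discrete_laplacian (h n) (newton_potential e F) z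
        + a * (2 * real DIM('a)))) \<longlonglongrightarrow> laplacian u z + ((- 1 / c) * (- L) + a * (2 * real DIM('a)))"
      unfolding L_def
      by (intro tendsto_add tendsto_mult tendsto_const
          discrete_laplacian_newton_potential_tendsto[OF dim e(1) F(1) hlim h]
          filterlim_compose[OF discrete_laplacian_tendsto[OF \<Omega>(1) z\<Omega> u(2) u(3)[OF z\<Omega>]] hlim])
    moreover have "discrete_laplacian (h n) u z + ((- 1 / c) * discrete_laplacian (h n) (newton_potential e F) z
        + a * (2 * real DIM('a))) = discrete_laplacian (h n) w z" for n
      using h[of n] unfolding w_def[abs_def]
      by (simp only: discrete_laplacian_add discrete_laplacian_cmult discrete_laplacian_norm_square)
    moreover have "eventually (\<lambda>n. discrete_laplacian (h n) w z \<le> 0) sequentially"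
      using closure_subset[of \<Omega>]
      by (intro eventually_compose_filterlim[OF discrete_laplacian_nonpos_at_max[OF \<Omega>(1) z\<Omega>] hlim] z(2)) auto
    ultimately have "laplacian u z + ((- 1 / c) * (- L) + a * (2 * real DIM('a))) \<le> 0"
      by (intro tendsto_upperbound[of _ _ sequentially]) auto
    moreover have "- laplacian u z \<le> F z" by (rule lap[OF z\<Omega>])
    moreover have "F z - a \<le> L / c"
      using newton_density_lower_bound[OF dim e(1) F(1,3) Fclose[OF z(1)]] c
      unfolding c_def[symmetric] L_def by (simp add: pos_le_divide_eq)
    moreover have "a < a * (2 * real DIM('a))"
      using a(1) dim by simp
    ultimately show False by simp
  qed
  then have "z \<in> frontier \<Omega>"
    using z(1) \<Omega>(1) by (simp add: frontier_def interior_open)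
  \<comment> \<open>On the boundary \<open>u\<close> is nonpositive and the potential is
    nonnegative, so only the quadratic term is left.\<close>
  then have "w z \<le> a * (norm z)\<^sup>2"
    using bdry[of z] divide_nonneg_pos[OF newton_potential_nonneg[of F e z] c] F(3)
    by (simp add: w_def)
  also have "\<dots> \<le> a * R\<^sup>2"
    using a(1) R(2)[OF z(1)] by (intro mult_left_mono power_mono) auto
  finally have "w x \<le> \<delta>" using z(2)[OF x] a(2) by linarith
  moreover have "u x \<le> w x + newton_potential e F x / c"
    using a(1) by (simp add: w_def)
  ultimately have "u x \<le> newton_potential e F x / c + \<delta>" by linarith
  with e(1) show ?thesis using that unfolding c_def by blast
qed

text \<open>The bound on the potential is uniform in \<open>e\<close>, so \<delta> can tend to 0
  although \<open>e\<close> depends on it. The constant depends on the dimension alone.\<close>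

lemma subsolution_sup_bound:
  assumes dim: "DIM('a::euclidean_space) \<ge> 3"
  obtains C where "0 \<le> C"
    "\<And>\<Omega> (u :: 'a \<Rightarrow> real) F K x.
      \<lbrakk>open \<Omega>; bounded \<Omega>; continuous_on (closure \<Omega>) u; \<And>x. x \<in> \<Omega> \<Longrightarrow> u differentiable (at x);
       \<And>h x. x \<in> \<Omega> \<Longrightarrow> (\<lambda>y. D1 u y h) differentiable (at x);
       \<And>x. x \<in> \<Omega> \<Longrightarrow> - laplacian u x \<le> F x; \<And>x. x \<in> frontier \<Omega> \<Longrightarrow> u x \<le> 0;
       integrable lborel F; continuous_on UNIV F; \<And>y. 0 \<le> F y; \<And>y. F y \<le> K; 0 < K;
       (LINT y|lborel. F y) \<le> 1; x \<in> closure \<Omega>\<rbrakk>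
      \<Longrightarrow> u x \<le> C * K powr (1 - 2 / real DIM('a))"
proof
  let ?A = "4 / 3 * 2 powr (real DIM('a) - 2) * measure lborel (cball (0::'a) 1) + 1"
  define c where "c = real DIM('a) * (real DIM('a) - 2)
    * 2 powr (- 1 - real DIM('a) / 2) * measure lborel (cball (0::'a) 1)"
  have c: "0 \<le> c" unfolding c_def using dim by simp
  then show "0 \<le> ?A / c" by simp
  fix \<Omega> and u F :: "'a \<Rightarrow> real" and K x
  assume a: "open \<Omega>" "bounded \<Omega>" "continuous_on (closure \<Omega>) u" "\<And>x. x \<in> \<Omega> \<Longrightarrow> u differentiable (at x)"
       "\<And>h x. x \<in> \<Omega> \<Longrightarrow> (\<lambda>y. D1 u y h) differentiable (at x)"
       "\<And>x. x \<in> \<Omega> \<Longrightarrow> - laplacian u x \<le> F x" "\<And>x. x \<in> frontier \<Omega> \<Longrightarrow> u x \<le> 0"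
    and F: "integrable lborel F" "continuous_on UNIV F" "\<And>y. 0 \<le> F y" "\<And>y. F y \<le> K" "0 < K"
       "(LINT y|lborel. F y) \<le> 1" and x: "x \<in> closure \<Omega>"
  show "u x \<le> ?A / c * K powr (1 - 2 / real DIM('a))"
  proof (rule field_le_epsilon)
    fix \<delta> :: real assume "0 < \<delta>"
    then obtain e where e: "0 < e" "u x \<le> newton_potential e F x / c + \<delta>"
      using subsolution_le_newton_potential[OF dim a F(1,2,3) _ x] unfolding c_def by metis
    have "newton_potential e F x / c \<le> ?A * K powr (1 - 2 / real DIM('a)) / c"
      using newton_potential_le[OF dim e(1) F(5,1,3,4,6)] c by (rule divide_right_mono)
    with e(2) show "u x \<le> ?A / c * K powr (1 - 2 / real DIM('a)) + \<delta>" by simp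
  qed
qed

subsection \<open>Solutions of the problem\<close>

text \<open>Beyond the threshold \<open>M0\<close>, where \<open>\<Lambda> * M0 powr q = M0\<close>,
  the linear term wins; below it the left side is at most its value at \<open>M0\<close>. For
  \<Lambda> equal to 0 the convention \<open>0 powr x = 0\<close> makes \<open>M0\<close> vanish,
  and the argument persists.\<close>

lemma sublinear_powr_bound:
  fixes q \<Lambda> :: real
  assumes q: "0 \<le> q" "q < 1" and \<Lambda>: "0 \<le> \<Lambda>"
  obtains A where "\<And>M. 0 < M \<Longrightarrow> \<Lambda> * M powr q \<le> M + A"
proof
  define M0 where "M0 = \<Lambda> powr (1 / (1 - q))"
  fix M :: real assume M: "0 < M"
  show "\<Lambda> * M powr q \<le> M + \<Lambda> * M0 powr q"
  proof (cases "M0 \<le> M")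
    case True
    have "\<Lambda> = M0 powr (1 - q)" using q \<Lambda> by (simp add: M0_def powr_powr)
    also have "\<dots> \<le> M powr (1 - q)"
      using True q by (intro powr_mono2) (auto simp: M0_def)
    finally have "\<Lambda> * M powr q \<le> M powr (1 - q) * M powr q"
      by (intro mult_right_mono) auto
    also have "\<dots> = M" using M by (simp add: powr_add[symmetric])
    finally show ?thesis using \<Lambda> by (simp add: add_increasing2)
  next
    case False
    then have "\<Lambda> * M powr q \<le> \<Lambda> * M0 powr q"
      using M q \<Lambda> by (intro mult_left_mono powr_mono2) auto
    then show ?thesis using M by linarith
  qed
qed

text \<open>Otherwise the integrand would vanish on \<Omega>, as \<open>0 powr p = 0\<close>, and
  the mass would be 0 instead of 1.\<close>

lemma solves_P_exists_pos:
  assumes sol: "solves_P \<beta> \<Omega> p lam \<alpha> \<psi>"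
  shows "\<exists>x\<in>\<Omega>. 0 < \<alpha> + lam * \<psi> x"
proof (rule ccontr)
  assume "\<not> ?thesis"
  then have "integral \<Omega> (\<lambda>x. (max (\<alpha> + lam * \<psi> x) 0) powr p) = integral \<Omega> (\<lambda>x. 0)"
    by (intro integral_cong) (auto simp: max_def not_less intro: antisym)
  then show False using sol by (simp add: solves_P_def)
qed

text \<open>\<open>M\<close> is the maximum of \<open>\<alpha> + lam * \<psi>\<close>, so
  \<open>M - \<alpha>\<close> is \<open>lam\<close> times the maximum of \<psi>. The sup bound
  applies with \<open>K = M powr p\<close>. What matters is that \<open>C\<close> is chosen before
  the domain, \<open>lam\<close> and \<alpha>.\<close>

lemma solves_P_sup_bound:
  assumes dim: "DIM('a::euclidean_space) \<ge> 3"
  obtains C where "0 \<le> C"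
    "\<And>\<Omega> \<beta> p lam \<alpha> (\<psi> :: 'a \<Rightarrow> real). \<lbrakk>open \<Omega>; bounded \<Omega>; 0 < p; 0 < lam; \<alpha> < 0; solves_P \<beta> \<Omega> p lam \<alpha> \<psi>\<rbrakk>
     \<Longrightarrow> \<exists>M>0. M - \<alpha> \<le> lam * (C * M powr (p * (1 - 2 / real DIM('a))))"
proof -
  obtain C where C: "0 \<le> C"
    "\<And>\<Omega> (u :: 'a \<Rightarrow> real) F K x.
      \<lbrakk>open \<Omega>; bounded \<Omega>; continuous_on (closure \<Omega>) u; \<And>x. x \<in> \<Omega> \<Longrightarrow> u differentiable (at x);
       \<And>h x. x \<in> \<Omega> \<Longrightarrow> (\<lambda>y. D1 u y h) differentiable (at x);
       \<And>x. x \<in> \<Omega> \<Longrightarrow> - laplacian u x \<le> F x; \<And>x. x \<in> frontier \<Omega> \<Longrightarrow> u x \<le> 0;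
       integrable lborel F; continuous_on UNIV F; \<And>y. 0 \<le> F y; \<And>y. F y \<le> K; 0 < K;
       (LINT y|lborel. F y) \<le> 1; x \<in> closure \<Omega>\<rbrakk>
      \<Longrightarrow> u x \<le> C * K powr (1 - 2 / real DIM('a))"
    using subsolution_sup_bound[OF dim] by blast
  show ?thesis
  proof (rule that[OF C(1)])
    fix \<Omega> \<beta> p lam \<alpha> and \<psi> :: "'a \<Rightarrow> real"
    assume \<Omega>: "open \<Omega>" "bounded \<Omega>" and p: "0 < p" and lam: "0 < lam" and \<alpha>: "\<alpha> < 0"
      and sol: "solves_P \<beta> \<Omega> p lam \<alpha> \<psi>"
    have cont: "continuous_on (closure \<Omega>) \<psi>"
      and diff: "\<And>x. x \<in> \<Omega> \<Longrightarrow> \<psi> differentiable (at x)"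
        "\<And>h x. x \<in> \<Omega> \<Longrightarrow> (\<lambda>y. D1 \<psi> y h) differentiable (at x)"
      and eq: "\<And>x. x \<in> \<Omega> \<Longrightarrow> - laplacian \<psi> x = (max (\<alpha> + lam * \<psi> x) 0) powr p"
      and bdry: "\<And>x. x \<in> frontier \<Omega> \<Longrightarrow> \<psi> x = 0"
      and mass: "integral \<Omega> (\<lambda>x. (max (\<alpha> + lam * \<psi> x) 0) powr p) = 1"
      using sol unfolding solves_P_def C2_holder_closure_def C2_holder_on_def by blast+
    obtain x0 where x0: "x0 \<in> \<Omega>" "0 < \<alpha> + lam * \<psi> x0"
      using solves_P_exists_pos[OF sol] by blast
    have comp: "compact (closure \<Omega>)" using \<Omega>(2) by (simp add: compact_closure)
    obtain z where z: "z \<in> closure \<Omega>" "\<And>y. y \<in> closure \<Omega> \<Longrightarrow> \<psi> y \<le> \<psi> z"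
      using continuous_attains_sup[OF comp _ cont] x0(1) closure_subset[of \<Omega>] by blast
    define M where "M = \<alpha> + lam * \<psi> z"
    have le_M: "\<alpha> + lam * \<psi> y \<le> M" if "y \<in> closure \<Omega>" for y
      using z(2)[OF that] lam by (simp add: M_def)
    have M: "0 < M" using le_M[of x0] x0 closure_subset[of \<Omega>] by force
    define f where "f y = (max (\<alpha> + lam * \<psi> y) 0) powr p" for y
    define F where "F y = (if y \<in> closure \<Omega> then f y else 0)" for y
    have f0: "f y = 0" if "y \<in> frontier \<Omega>" for y
      using bdry[OF that] \<alpha> by (simp add: f_def max_def)
    \<comment> \<open>Positivity of \<open>p\<close> makes the power continuous at base 0.\<close>
    have fcont: "continuous_on (closure \<Omega>) f"
      unfolding f_def[abs_def] using p
      by (intro continuous_on_powr' continuous_intros cont) auto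
    \<comment> \<open>No jump across the boundary: there \<open>\<psi> = 0\<close> and \<open>\<alpha> < 0\<close>, so \<open>f\<close> vanishes.\<close>
    have Fcont: "continuous_on UNIV F"
    proof -
      have "continuous_on (closure \<Omega> \<union> - \<Omega>) (\<lambda>y. if y \<in> closure \<Omega> then f y else 0)"
        using \<Omega>(1) f0
        by (intro continuous_on_cases fcont continuous_on_const)
           (auto simp: frontier_def interior_open)
      moreover have "closure \<Omega> \<union> - \<Omega> = UNIV" using closure_subset[of \<Omega>] by auto
      ultimately show ?thesis by (simp add: F_def[abs_def])
    qed
    have Fint: "integrable lborel F"
    proof -
      have "F = (\<lambda>x. indicator (closure \<Omega>) x *\<^sub>R f x)"
        by (auto simp: F_def indicator_def)
      then show ?thesis using borel_integrable_compact[OF comp fcont] by simp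
    qed
    \<comment> \<open>The mass is given as a gauge integral over \<Omega>, the potential uses the
      Lebesgue integral of \<open>F\<close>. Since \<open>f\<close> vanishes on the frontier, the
      two integrands agree at every point.\<close>
    have "(F has_integral (LINT y|lborel. F y)) UNIV"
      using has_integral_integral_lborel[OF Fint] .
    moreover have "(LINT y|lborel. F y) = integral UNIV F"
      using calculation by (simp add: integral_unique)
    moreover have "integral UNIV F = integral UNIV (\<lambda>y. if y \<in> \<Omega> then f y else 0)"
    proof (rule integral_cong)
      fix y show "F y = (if y \<in> \<Omega> then f y else 0)"
        using f0[of y] \<Omega>(1) closure_subset[of \<Omega>] by (auto simp: F_def frontier_def interior_open)
    qed
    moreover have "\<dots> = 1"
      using mass by (simp add: integral_restrict_UNIV f_def)
    ultimately have F1: "(LINT y|lborel. F y) = 1" by simp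
    have Fnonneg: "0 \<le> F y" for y
      by (simp add: F_def f_def)
    have FK: "F y \<le> M powr p" for y
    proof (cases "y \<in> closure \<Omega>")
      case True
      then show ?thesis
        unfolding F_def f_def using le_M[OF True] M p by (auto intro!: powr_mono2)
    qed (simp add: F_def)
    have "\<psi> z \<le> C * (M powr p) powr (1 - 2 / real DIM('a))"
    proof (rule C(2)[OF \<Omega> cont diff])
      show "- laplacian \<psi> x \<le> F x" if "x \<in> \<Omega>" for x
        using eq[OF that] that closure_subset[of \<Omega>] by (auto simp: F_def f_def)
    qed (use bdry Fint Fcont Fnonneg FK F1 M z in auto)
    then have "lam * \<psi> z \<le> lam * (C * M powr (p * (1 - 2 / real DIM('a))))"
      using lam by (simp add: powr_powr)
    then show "\<exists>M>0. M - \<alpha> \<le> lam * (C * M powr (p * (1 - 2 / real DIM('a))))"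
      using M by (intro exI[of _ M]) (simp add: M_def)
  qed
qed

theorem theorem7p1:
  fixes \<Omega> :: "'a::euclidean_space set"
    and \<beta> p :: real
    and lam \<alpha> :: "nat \<Rightarrow> real"
    and \<psi> :: "nat \<Rightarrow> 'a \<Rightarrow> real"
  assumes "DIM('a) \<ge> 3"
    and "1 \<le> p" and "p < real DIM('a) / (real DIM('a) - 2)"
    and "0 < \<beta>" and "\<beta> < 1"
    and "C2_holder_domain \<beta> \<Omega>"
    and "measure lebesgue \<Omega> = 1"
    and "\<forall>n. 0 < lam n"
    and "\<forall>n. solves_P \<beta> \<Omega> p (lam n) (\<alpha> n) (\<psi> n)"
    and "\<forall>n. \<alpha> n < 0"
    and "filterlim (\<lambda>n. \<bar>\<alpha> n\<bar>) at_top sequentially"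
  shows "filterlim lam at_top sequentially \<and>
         filterlim (\<lambda>n. lam n * (SUP x\<in>closure \<Omega>. \<bar>\<psi> n x\<bar>)) at_top sequentially"
proof
  have \<Omega>: "open \<Omega>" "bounded \<Omega>"
    using assms(6) by (auto simp: C2_holder_domain_def)
  define q where "q = p * (1 - 2 / real DIM('a))"
  \<comment> \<open>The inequality \<open>q < 1\<close> is exactly the subcriticality assumption on
    \<open>p\<close>.\<close>
  have q: "0 \<le> q" "q < 1"
    using assms(1-3) by (auto simp: q_def field_simps)
  obtain C where C: "0 \<le> C"
    "\<And>\<Omega> \<beta> p lam \<alpha> (\<psi> :: 'a \<Rightarrow> real). \<lbrakk>open \<Omega>; bounded \<Omega>; 0 < p; 0 < lam; \<alpha> < 0; solves_P \<beta> \<Omega> p lam \<alpha> \<psi>\<rbrakk>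
     \<Longrightarrow> \<exists>M>0. M - \<alpha> \<le> lam * (C * M powr (p * (1 - 2 / real DIM('a))))"
    using solves_P_sup_bound[OF assms(1)] by blast
  show "filterlim lam at_top sequentially"
    unfolding filterlim_at_top
  proof
    fix Z :: real
    \<comment> \<open>\<open>Z\<close> may be negative, whereas the sublinear bound needs a
      nonnegative coefficient. \<open>A\<close> depends on \<open>Z\<close> but not on
      \<open>n\<close>.\<close>
    obtain A where A: "\<And>M. 0 < M \<Longrightarrow> (max Z 0 * C) * M powr q \<le> M + A"
      using sublinear_powr_bound[OF q, of "max Z 0 * C"] C(1) by auto
    \<comment> \<open>The extra 1 makes the contradiction strict: if \<open>lam n < Z\<close>, then
      \<open>M + \<bar>\<alpha> n\<bar> \<le> M + A\<close>.\<close>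
    have "eventually (\<lambda>n. A + 1 \<le> \<bar>\<alpha> n\<bar>) sequentially"
      using assms(11) by (simp add: filterlim_at_top)
    then show "eventually (\<lambda>n. Z \<le> lam n) sequentially"
    proof eventually_elim
      case (elim n)
      show ?case
      proof (rule ccontr)
        assume "\<not> Z \<le> lam n"
        obtain M where M: "0 < M" "M - \<alpha> n \<le> lam n * (C * M powr q)"
          using C(2)[OF \<Omega>, of p "lam n" "\<alpha> n" \<beta> "\<psi> n"] assms(2,8,9,10) unfolding q_def by auto
        have "lam n * (C * M powr q) \<le> max Z 0 * (C * M powr q)"
          using \<open>\<not> Z \<le> lam n\<close> C(1) by (intro mult_right_mono) auto
        also have "\<dots> \<le> M + A" using A[OF M(1)] by (simp add: mult.assoc)
        finally show False using M(2) elim assms(10) by (simp add: abs_of_neg)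
      qed
    qed
  qed
  show "filterlim (\<lambda>n. lam n * (SUP x\<in>closure \<Omega>. \<bar>\<psi> n x\<bar>)) at_top sequentially"
  \<comment> \<open>The sequence \<open>\<bar>\<alpha> n\<bar>\<close> is itself a lower bound: at a
    point where \<open>\<alpha> n + lam n * \<psi> n x\<close> is positive, the second term exceeds
    it.\<close>
  proof (rule filterlim_at_top_mono[OF assms(11)], rule always_eventually, rule allI)
    fix n
    have sol: "solves_P \<beta> \<Omega> p (lam n) (\<alpha> n) (\<psi> n)" using assms(9) by blast
    then have "continuous_on (closure \<Omega>) (\<psi> n)"
      by (simp add: solves_P_def C2_holder_closure_def)
    then have "compact ((\<lambda>x. \<bar>\<psi> n x\<bar>) ` closure \<Omega>)"
      using \<Omega>(2) by (intro compact_continuous_image continuous_intros) (simp_all add: compact_closure)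
    \<comment> \<open>The real supremum dominates the values only once they are known to be bounded
      above.\<close>
    then have bdd: "bdd_above ((\<lambda>x. \<bar>\<psi> n x\<bar>) ` closure \<Omega>)"
      by (intro bounded_imp_bdd_above compact_imp_bounded)
    obtain x where x: "x \<in> \<Omega>" "0 < \<alpha> n + lam n * \<psi> n x"
      using solves_P_exists_pos[OF sol] by blast
    have "\<bar>\<alpha> n\<bar> \<le> lam n * \<bar>\<psi> n x\<bar>"
      using x(2) assms(8,10) by (smt (verit) mult_left_mono)
    also have "\<dots> \<le> lam n * (SUP x\<in>closure \<Omega>. \<bar>\<psi> n x\<bar>)"
      using x(1) closure_subset[of \<Omega>] assms(8)
      by (intro mult_left_mono cSUP_upper bdd) (auto intro: less_imp_le)
    finally show "\<bar>\<alpha> n\<bar> \<le> lam n * (SUP x\<in>closure \<Omega>. \<bar>\<psi> n x\<bar>)" .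
  qed
qed

end
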